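(* Let $L$ be a completely distributive lattice and let $G$ be a group. (1) Let $\mu$ be an $L$-subgroup of $G$ and let $\eta$ be an $L$-subgroup of $\mu$ such that $\operatorname{tip}(\eta)=\operatorname{tip}(\mu)$. If $\eta_t$ is an abnormal subgroup of $\mu_t$ for all $t\in L$ with $t\le \operatorname{tip}(\eta)$, then $\eta$ is an abnormal $L$-subgroup of $\mu$. (2) Conversely, suppose $L$ is an upper well ordered lattice, let $\mu$ be an $L$-subgroup of $G$ and let $\eta$ be an $L$-subgroup of $\mu$. If $\eta$ is an abnormal $L$-subgroup of $\mu$, then $\eta_t$ is an abnormal subgroup of $\mu_t$ for all $t\in L$ with $t\le\operatorname{tip}(\eta)$.
   Context: $L$ is a completely distributive (in particular complete) lattice with greatest element $1$ and least element $0$; $G$ is a group with identity $e$. $L$ is called upper well ordered if every non-empty subset of $L$ contains its supremum. An $L$-subset of $G$ is a function $G\to L$; $\eta\subseteq\nu$ means $\eta(x)\le\nu(x)$ for all $x\in G$; $(\eta\cup\nu)(x)=\eta(x)\vee\nu(x)$. For $t\in L$ the level subset is $\eta_t=\{x\in G\mid \eta(x)\ge t\}$. An $L$-subgroup of $G$ is an $L$-subset $\mu$ with $\mu(xy)\ge\mu(x)\wedge\mu(y)$ and $\mu(x^{-1})=\mu(x)$ for all $x,y\in G$. Its tip is $\operatorname{tip}(\mu)=\bigvee_{x\in G}\mu(x)=\mu(e)$. An $L$-subgroup of $\mu$ is an $L$-subgroup $\eta$ of $G$ with $\eta\subseteq\mu$. For $t \le \operatorname{tip}(\eta)$, $\eta_t$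 is a subgroup of $\mu_t$. For $a\in L$, $x\in G$, the $L$-point $a_x$ is the $L$-subset with value $a$ at $x$ and $0$ elsewhere; $a_x\in\mu$ means $\mu(x)\ge a$. For $\eta$ an $L$-subgroup of $\mu$ and $a_z\in\mu$, the conjugate $\eta^{a_z}$ is the $L$-subset $\eta^{a_z}(x)=a\wedge\eta(zxz^{-1})$, $x\in G$ (it is an $L$-subgroup of $\mu$). For $L$-subsets $\eta,\nu\subseteq\mu$, $\langle\eta,\nu\rangle$ is the $L$-subgroup of $\mu$ generated by $\eta\cup\nu$, i.e. the pointwise infimum of all $L$-subgroups $\theta$ of $\mu$ with $\eta\cup\nu\subseteq\theta$. An $L$-subgroup $\eta$ of $\mu$ is an abnormal $L$-subgroup of $\mu$ if for every $L$-point $a_x\in\mu$ one has $a_x\in\langle\eta,\eta^{a_x}\rangle$. A subgroup $H$ of a group $K$ is abnormal in $K$ if $x\in\langle H,H^x\rangle$ for all $x\in K$, where $H^x=xHx^{-1}$. *)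

theory Defs
  imports "HOL-Algebra.Generated_Groups"
begin

(* The binary inf and sup below are those of the lattice type classes, not the HOL-Algebra ones. *)
hide_const (open) Lattice.inf Lattice.sup

text \<open>
  An L-subset of a group G is a function on the underlying type of G of which only the values on
  carrier G matter; every condition below is therefore relativised to carrier G.
\<close>

definition upper_well_ordered :: "'l::complete_lattice itself \<Rightarrow> bool" where
  "upper_well_ordered _ \<longleftrightarrow> (\<forall>S::'l set. S \<noteq> {} \<longrightarrow> Sup S \<in> S)"

definition L_subset_le :: "('g, 'b) monoid_scheme \<Rightarrow> ('g \<Rightarrow> 'l::complete_lattice) \<Rightarrow> ('g \<Rightarrow> 'l) \<Rightarrow> bool"
  where "L_subset_le G \<eta> \<nu> \<longleftrightarrow> (\<forall>x\<in>carrier G. \<eta> x \<le> \<nu> x)"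

definition L_level :: "('g, 'b) monoid_scheme \<Rightarrow> ('g \<Rightarrow> 'l::complete_lattice) \<Rightarrow> 'l \<Rightarrow> 'g set" where
  "L_level G \<eta> t = {x \<in> carrier G. t \<le> \<eta> x}"

definition L_subgroup :: "('g, 'b) monoid_scheme \<Rightarrow> ('g \<Rightarrow> 'l::complete_lattice) \<Rightarrow> bool" where
  "L_subgroup G \<mu> \<longleftrightarrow>
     (\<forall>x\<in>carrier G. \<forall>y\<in>carrier G. inf (\<mu> x) (\<mu> y) \<le> \<mu> (x \<otimes>\<^bsub>G\<^esub> y)) \<and>
     (\<forall>x\<in>carrier G. \<mu> (inv\<^bsub>G\<^esub> x) = \<mu> x)"

definition L_tip :: "('g, 'b) monoid_scheme \<Rightarrow> ('g \<Rightarrow> 'l::complete_lattice) \<Rightarrow> 'l" where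
  "L_tip G \<mu> = (SUP x\<in>carrier G. \<mu> x)"

definition L_subgroup_of ::
    "('g, 'b) monoid_scheme \<Rightarrow> ('g \<Rightarrow> 'l::complete_lattice) \<Rightarrow> ('g \<Rightarrow> 'l) \<Rightarrow> bool" where
  "L_subgroup_of G \<eta> \<mu> \<longleftrightarrow> L_subgroup G \<eta> \<and> L_subset_le G \<eta> \<mu>"

text \<open>
  The L-point with value a at x is represented by the pair of a and x, because the conjugate by an
  L-point depends on x even when a is the least element.
\<close>

definition L_point_in :: "'l::complete_lattice \<Rightarrow> 'g \<Rightarrow> ('g \<Rightarrow> 'l) \<Rightarrow> bool" where
  "L_point_in a x \<mu> \<longleftrightarrow> a \<le> \<mu> x"

definition L_conjugate ::
    "('g, 'b) monoid_scheme \<Rightarrow> ('g \<Rightarrow> 'l::complete_lattice) \<Rightarrow> 'l \<Rightarrow> 'g \<Rightarrow> 'g \<Rightarrow> 'l" where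
  "L_conjugate G \<eta> a z = (\<lambda>x. inf a (\<eta> (z \<otimes>\<^bsub>G\<^esub> x \<otimes>\<^bsub>G\<^esub> inv\<^bsub>G\<^esub> z)))"

definition L_generated ::
    "('g, 'b) monoid_scheme \<Rightarrow> ('g \<Rightarrow> 'l::complete_lattice) \<Rightarrow> ('g \<Rightarrow> 'l) \<Rightarrow> ('g \<Rightarrow> 'l) \<Rightarrow> 'g \<Rightarrow> 'l"
  where "L_generated G \<mu> \<eta> \<nu> =
    (\<lambda>x. INF \<theta>\<in>{\<theta>. L_subgroup_of G \<theta> \<mu> \<and> L_subset_le G (\<lambda>y. sup (\<eta> y) (\<nu> y)) \<theta>}. \<theta> x)"

definition abnormal_L_subgroup ::
    "('g, 'b) monoid_scheme \<Rightarrow> ('g \<Rightarrow> 'l::complete_lattice) \<Rightarrow> ('g \<Rightarrow> 'l) \<Rightarrow> bool" where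
  "abnormal_L_subgroup G \<eta> \<mu> \<longleftrightarrow> L_subgroup_of G \<eta> \<mu> \<and>
     (\<forall>a. \<forall>x\<in>carrier G. L_point_in a x \<mu> \<longrightarrow>
        L_point_in a x (L_generated G \<mu> \<eta> (L_conjugate G \<eta> a x)))"

text \<open>The subgroup conjugate is x H x^-1, whereas L-points conjugate the opposite way round.\<close>

definition abnormal_subgroup :: "'g set \<Rightarrow> ('g, 'b) monoid_scheme \<Rightarrow> bool" where
  "abnormal_subgroup H K \<longleftrightarrow> group K \<and> subgroup H K \<and>
     (\<forall>x\<in>carrier K. x \<in> generate K (H \<union> (x <#\<^bsub>K\<^esub> H #>\<^bsub>K\<^esub> inv\<^bsub>K\<^esub> x)))"

end

theory Submission
  imports Defs
begin

text \<open>
  The level subsets of an L-subgroup are subgroups. If every level is abnormal and a is at most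
  the value of \<mu> at x, then every L-subgroup \<theta> containing \<eta> and its conjugate has a level
  at a containing the level of \<eta> and its classical conjugate, hence x.

  Conversely, in an upper well ordered lattice the set of elements strictly below t contains its
  supremum t'. For K the subgroup generated by the level of \<eta> at t and its conjugate, the L-subset
  equal to \<mu> on K and to the meet of t' and \<mu> off K is an L-subgroup of \<mu> containing \<eta>
  and its conjugate by the L-point; it therefore takes a value of at least t at x, which forces
  x to lie in K.
\<close>

lemma (in group) L_subgroup_mult:
  "\<lbrakk>L_subgroup G \<mu>; x \<in> carrier G; y \<in> carrier G\<rbrakk> \<Longrightarrow> inf (\<mu> x) (\<mu> y) \<le> \<mu> (x \<otimes> y)"
  by (simp add: L_subgroup_def)

lemma (in group) L_subgroup_inv:
  "\<lbrakk>L_subgroup G \<mu>; x \<in> carrier G\<rbrakk> \<Longrightarrow> \<mu> (inv x) = \<mu> x"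
  by (simp add: L_subgroup_def)

lemma (in group) L_subgroup_le_one:
  assumes "L_subgroup G \<mu>" "x \<in> carrier G"
  shows "\<mu> x \<le> \<mu> \<one>"
  using L_subgroup_mult[of \<mu> x "inv x"] assms by (simp add: L_subgroup_inv)

lemma (in group) L_tip_eq_one:
  assumes "L_subgroup G \<mu>"
  shows "L_tip G \<mu> = \<mu> \<one>"
  unfolding L_tip_def
  by (intro antisym SUP_least SUP_upper) (simp_all add: assms L_subgroup_le_one)

text \<open>Bounding \<open>t\<close> by the value at the identity, the largest value of
  \<open>\<mu>\<close>, is what makes the level non-empty.\<close>

lemma (in group) L_level_subgroup:
  assumes "L_subgroup G \<mu>" "t \<le> \<mu> \<one>"
  shows "subgroup (L_level G \<mu> t) G"
proof (rule subgroup.intro)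
  fix x y assume "x \<in> L_level G \<mu> t" "y \<in> L_level G \<mu> t"
  then show "x \<otimes> y \<in> L_level G \<mu> t"
    using order_trans[OF _ L_subgroup_mult[OF assms(1)], of t x y]
    by (simp add: L_level_def)
qed (use assms in \<open>auto simp: L_level_def L_subgroup_inv\<close>)

lemma (in group) conj_conj_inv:
  assumes "x \<in> carrier G" "y \<in> carrier G"
  shows "x \<otimes> (inv x \<otimes> y \<otimes> x) \<otimes> inv x = y"
proof -
  have "x \<otimes> (inv x \<otimes> y \<otimes> x) \<otimes> inv x = (x \<otimes> inv x) \<otimes> y \<otimes> (x \<otimes> inv x)"
    by (simp only: assms m_assoc m_closed inv_closed)
  then show ?thesis using assms by simp
qed

text \<open>Conjugating back writes \<open>y\<close> as a product of \<open>inv x\<close>,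
  \<open>x \<otimes> y \<otimes> inv x\<close> and \<open>x\<close>, so two uses of the product law
  suffice. This later keeps the conjugate of \<open>\<eta>\<close> by an L-point below
  \<open>\<mu>\<close>.\<close>

lemma (in group) L_subgroup_conj:
  assumes "L_subgroup G \<mu>" "x \<in> carrier G" "y \<in> carrier G"
  shows "inf (\<mu> x) (\<mu> (x \<otimes> y \<otimes> inv x)) \<le> \<mu> y"
proof -
  have y: "y = inv x \<otimes> (x \<otimes> y \<otimes> inv x) \<otimes> x"
    using conj_conj_inv[of "inv x" y] assms by simp
  have "inf (\<mu> x) (\<mu> (x \<otimes> y \<otimes> inv x)) \<le> \<mu> (inv x \<otimes> (x \<otimes> y \<otimes> inv x))"
    using L_subgroup_mult[of \<mu> "inv x" "x \<otimes> y \<otimes> inv x"] assms by (simp add: L_subgroup_inv)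
  then have "inf (\<mu> x) (\<mu> (x \<otimes> y \<otimes> inv x)) \<le> inf (\<mu> (inv x \<otimes> (x \<otimes> y \<otimes> inv x))) (\<mu> x)"
    by simp
  also have "\<dots> \<le> \<mu> y"
    using L_subgroup_mult[of \<mu> "inv x \<otimes> (x \<otimes> y \<otimes> inv x)" x] assms y[symmetric] by simp
  finally show ?thesis .
qed

lemma L_level_mono:
  "L_subset_le G \<eta> \<nu> \<Longrightarrow> L_level G \<eta> t \<subseteq> L_level G \<nu> t"
  by (auto simp: L_level_def L_subset_le_def intro: order_trans)

lemma (in group) abnormal_L_subgroupI_levels:
  fixes \<mu> \<eta> :: "'a \<Rightarrow> 'l::complete_lattice"
  assumes \<mu>: "L_subgroup G \<mu>" and \<eta>\<mu>: "L_subgroup_of G \<eta> \<mu>" and tip: "L_tip G \<eta> = L_tip G \<mu>"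
    and lev: "\<And>t. t \<le> L_tip G \<eta> \<Longrightarrow>
      abnormal_subgroup (L_level G \<eta> t) (G\<lparr>carrier := L_level G \<mu> t\<rparr>)"
  shows "abnormal_L_subgroup G \<eta> \<mu>"
  unfolding abnormal_L_subgroup_def L_point_in_def L_generated_def
proof (intro conjI \<eta>\<mu> allI ballI impI INF_greatest)
  fix a x \<theta>
  assume x: "x \<in> carrier G" and a: "a \<le> \<mu> x"
    and "\<theta> \<in> {\<theta>. L_subgroup_of G \<theta> \<mu> \<and>
      L_subset_le G (\<lambda>y. sup (\<eta> y) (L_conjugate G \<eta> a x y)) \<theta>}"
  then have \<theta>: "L_subgroup G \<theta>" and \<theta>\<mu>: "L_subset_le G \<theta> \<mu>"
    and \<eta>\<theta>: "L_subset_le G \<eta> \<theta>" and conj\<theta>: "L_subset_le G (L_conjugate G \<eta> a x) \<theta>"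
    by (auto simp: L_subgroup_of_def L_subset_le_def)
  have \<eta>: "L_subgroup G \<eta>" using \<eta>\<mu> by (simp add: L_subgroup_of_def)
  let ?M = "G\<lparr>carrier := L_level G \<mu> a\<rparr>"
  have a1: "a \<le> \<mu> \<one>" using a L_subgroup_le_one[OF \<mu> x] by simp
  \<comment> \<open>Equality of the tips enters here: it carries the bound on \<open>a\<close> from
    \<open>\<mu>\<close> over to \<open>\<eta>\<close>, and from there to \<open>\<theta>\<close>,
    whose level at \<open>a\<close> is then a subgroup.\<close>
  then have "a \<le> \<eta> \<one>" using tip \<eta> \<mu> by (simp add: L_tip_eq_one)
  then have a\<theta>: "a \<le> \<theta> \<one>" using \<eta>\<theta> by (auto simp: L_subset_le_def intro: order_trans)
  have subM: "subgroup (L_level G \<mu> a) G" by (rule L_level_subgroup[OF \<mu> a1])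
  have sub\<theta>: "subgroup (L_level G \<theta> a) G" by (rule L_level_subgroup[OF \<theta> a\<theta>])
  have xM: "x \<in> L_level G \<mu> a" using x a by (simp add: L_level_def)
  then have x'M: "inv x \<in> L_level G \<mu> a" using subM by (rule subgroup.m_inv_closed[rotated])
  have invM: "inv\<^bsub>?M\<^esub> (inv x) = x" using m_inv_consistent[OF subM x'M] x by simp
  let ?S = "L_level G \<eta> a \<union> (inv x <#\<^bsub>?M\<^esub> L_level G \<eta> a #>\<^bsub>?M\<^esub> inv\<^bsub>?M\<^esub> (inv x))"
  have "a \<le> L_tip G \<eta>" using a1 tip \<mu> by (simp add: L_tip_eq_one)
  then have ab: "abnormal_subgroup (L_level G \<eta> a) ?M" by (rule lev)
  \<comment> \<open>L-points conjugate the opposite way round, hence the inverse.\<close>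
  have "inv x \<in> generate ?M ?S"
    using ab x'M unfolding abnormal_subgroup_def by auto
  moreover have "?S \<subseteq> L_level G \<theta> a"
  proof -
    \<comment> \<open>The conjugate by the L-point at \<open>x\<close> evaluates
      \<open>\<eta>\<close> at
      \<open>x \<otimes> (inv x \<otimes> h \<otimes> x) \<otimes> inv x\<close>, which is
      \<open>h\<close>. As \<open>h\<close> lies in the level at \<open>a\<close>, the meet with
      \<open>a\<close> is \<open>a\<close> itself.\<close>
    have "inv x \<otimes> h \<otimes> x \<in> L_level G \<theta> a" if h: "h \<in> L_level G \<eta> a" for h
    proof -
      have hG: "h \<in> carrier G" using h by (simp add: L_level_def)
      have "x \<otimes> (inv x \<otimes> h \<otimes> x) \<otimes> inv x = h"
        by (rule conj_conj_inv[OF x hG])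
      then have "a \<le> L_conjugate G \<eta> a x (inv x \<otimes> h \<otimes> x)"
        using h by (simp add: L_conjugate_def L_level_def)
      also have "\<dots> \<le> \<theta> (inv x \<otimes> h \<otimes> x)"
        using conj\<theta> x hG by (simp add: L_subset_le_def)
      finally show ?thesis using x hG by (simp add: L_level_def)
    qed
    then show ?thesis
      using L_level_mono[OF \<eta>\<theta>] unfolding invM by (auto simp: l_coset_def r_coset_def)
  qed
  \<comment> \<open>Generation takes place inside \<open>?M\<close>, so the level of
    \<open>\<theta>\<close> has to be a subgroup there; it lies in \<open>?M\<close> because
    \<open>\<theta>\<close> is below \<open>\<mu>\<close>.\<close>
  moreover have "subgroup (L_level G \<theta> a) ?M"
    by (rule subgroup_incl[OF sub\<theta> subM L_level_mono[OF \<theta>\<mu>]])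
  ultimately have "inv x \<in> L_level G \<theta> a"
    using group.generate_subgroup_incl[OF subgroup_imp_group[OF subM]] by blast
  then show "a \<le> \<theta> x" using x \<theta> by (simp add: L_level_def L_subgroup_inv)
qed

text \<open>A two-element set contains its supremum only if its elements are comparable, so an upper
  well ordered lattice is a chain.\<close>

lemma upper_well_ordered_not_le:
  fixes s t :: "'l::complete_lattice"
  assumes "upper_well_ordered TYPE('l)" "\<not> t \<le> s"
  shows "s < t"
proof -
  from assms(1)[unfolded upper_well_ordered_def, rule_format, of "{s, t}"]
  have "sup s t = s \<or> sup s t = t" by simp
  then have "s \<le> t" using assms(2) by (metis sup_ge1 sup_ge2)
  with assms(2) show ?thesis by (auto simp: less_le)
qed

text \<open>A product outside \<open>K\<close> has a factor outside \<open>K\<close>, whose value is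
  already capped by \<open>s\<close>; hence capping off a subgroup respects the product law.
  Inversion neither enters nor leaves \<open>K\<close>.\<close>

lemma (in group) L_subgroup_cut_off:
  assumes \<mu>: "L_subgroup G \<mu>" and K: "subgroup K G"
  shows "L_subgroup G (\<lambda>y. if y \<in> K then \<mu> y else inf s (\<mu> y))"
  unfolding L_subgroup_def
proof (intro conjI ballI)
  fix x assume x: "x \<in> carrier G"
  then have "inv x \<in> K \<longleftrightarrow> x \<in> K"
    using subgroup.m_inv_closed[OF K] inv_inv by metis
  then show "(if inv x \<in> K then \<mu> (inv x) else inf s (\<mu> (inv x))) = (if x \<in> K then \<mu> x else inf s (\<mu> x))"
    using \<mu> x by (simp add: L_subgroup_inv)
next
  fix x y assume xy: "x \<in> carrier G" "y \<in> carrier G"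
  let ?\<theta> = "\<lambda>y. if y \<in> K then \<mu> y else inf s (\<mu> y)"
  have "inf (?\<theta> x) (?\<theta> y) \<le> inf (\<mu> x) (\<mu> y)" by (rule inf_mono) auto
  also have "\<dots> \<le> \<mu> (x \<otimes> y)" by (rule L_subgroup_mult[OF \<mu> xy])
  finally have "inf (?\<theta> x) (?\<theta> y) \<le> \<mu> (x \<otimes> y)" .
  moreover have "inf (?\<theta> x) (?\<theta> y) \<le> s" if "x \<otimes> y \<notin> K"
  proof -
    have "x \<notin> K \<or> y \<notin> K" using that K by (auto intro: subgroup.m_closed)
    then show ?thesis by (auto intro: le_infI1 le_infI2)
  qed
  ultimately show "inf (?\<theta> x) (?\<theta> y) \<le> ?\<theta> (x \<otimes> y)" by simp
qed

lemma (in group) abnormal_L_subgroup_level: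
  fixes \<mu> \<eta> :: "'a \<Rightarrow> 'l::complete_lattice"
  assumes uwo: "upper_well_ordered TYPE('l)" and \<mu>: "L_subgroup G \<mu>"
    and ab: "abnormal_L_subgroup G \<eta> \<mu>" and t: "t \<le> L_tip G \<eta>"
  shows "abnormal_subgroup (L_level G \<eta> t) (G\<lparr>carrier := L_level G \<mu> t\<rparr>)"
proof -
  let ?H = "L_level G \<eta> t" and ?M = "G\<lparr>carrier := L_level G \<mu> t\<rparr>"
  have \<eta>: "L_subgroup G \<eta>" and \<eta>\<mu>: "L_subset_le G \<eta> \<mu>"
    using ab by (auto simp: abnormal_L_subgroup_def L_subgroup_of_def)
  have t\<eta>: "t \<le> \<eta> \<one>" using t \<eta> by (simp add: L_tip_eq_one)
  then have t\<mu>: "t \<le> \<mu> \<one>" using \<eta>\<mu> by (auto simp: L_subset_le_def intro: order_trans)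
  have subM: "subgroup (L_level G \<mu> t) G" by (rule L_level_subgroup[OF \<mu> t\<mu>])
  have subH: "subgroup ?H G" by (rule L_level_subgroup[OF \<eta> t\<eta>])
  have groupM: "group ?M" by (rule subgroup_imp_group[OF subM])
  have "x \<in> generate ?M (?H \<union> (x <#\<^bsub>?M\<^esub> ?H #>\<^bsub>?M\<^esub> inv\<^bsub>?M\<^esub> x))"
    if xM: "x \<in> L_level G \<mu> t" for x
  proof (rule ccontr)
    define S where "S = ?H \<union> (x <#\<^bsub>?M\<^esub> ?H #>\<^bsub>?M\<^esub> inv\<^bsub>?M\<^esub> x)"
    define K where "K = generate ?M S"
    define s where "s = Sup {r. r < t}"
    define \<theta> where "\<theta> = (\<lambda>y. if y \<in> K then \<mu> y else inf s (\<mu> y))"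
    assume "x \<notin> generate ?M (?H \<union> (x <#\<^bsub>?M\<^esub> ?H #>\<^bsub>?M\<^esub> inv\<^bsub>?M\<^esub> x))"
    then have xK: "x \<notin> K" by (simp add: K_def S_def)
    have x: "x \<in> carrier G" and tx: "t \<le> \<mu> x" using xM by (auto simp: L_level_def)
    have invM: "inv\<^bsub>?M\<^esub> x = inv x" by (rule m_inv_consistent[OF subM xM])
    have S: "S = ?H \<union> (\<lambda>h. x \<otimes> h \<otimes> inv x) ` ?H"
      unfolding S_def invM by (auto simp: l_coset_def r_coset_def)
    have "?H \<subseteq> L_level G \<mu> t" by (rule L_level_mono[OF \<eta>\<mu>])
    then have SM: "S \<subseteq> carrier ?M"
      using subM xM by (auto simp: S intro!: subgroup.m_closed subgroup.m_inv_closed)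
    have K: "subgroup K G"
      unfolding K_def using group.generate_is_subgroup[OF groupM SM] subM
      by (rule incl_subgroup[rotated])
    have SK: "S \<subseteq> K" unfolding K_def by (auto intro: generate.incl)
    \<comment> \<open>In a chain, failing to lie above \<open>t\<close> means lying strictly below
      it, hence under \<open>s\<close>. Off \<open>K\<close> it is therefore enough to show that a
      value does not reach \<open>t\<close>.\<close>
    have below: "r \<le> s" if "\<not> t \<le> r" for r
      unfolding s_def using upper_well_ordered_not_le[OF uwo that] by (simp add: Sup_upper)
    \<comment> \<open>The value \<open>\<eta> x\<close> witnesses that something lies strictly below
      \<open>t\<close>, which rules out \<open>t\<close> being the least element. The set defining
      \<open>s\<close> is then non-empty and contains \<open>s\<close>, so \<open>s\<close> is the
      largest element strictly below \<open>t\<close>.\<close>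
    have "\<not> t \<le> \<eta> x" using xK SK x by (auto simp: S L_level_def)
    then have "{r. r < t} \<noteq> {}" using upper_well_ordered_not_le[OF uwo] by auto
    with uwo[unfolded upper_well_ordered_def, rule_format] have "s \<in> {r. r < t}"
      unfolding s_def .
    then have s: "s < t" by simp
    have "L_subgroup_of G \<theta> \<mu>"
      unfolding L_subgroup_of_def \<theta>_def
      using L_subgroup_cut_off[OF \<mu> K] by (auto simp: L_subset_le_def)
    \<comment> \<open>The L-point is placed at \<open>inv x\<close> so that, on the carrier, its
      conjugate of \<open>\<eta>\<close> reaches \<open>t\<close> exactly on the classical conjugate
      of \<open>?H\<close> by \<open>x\<close>, which lies in \<open>K\<close>.\<close>
    moreover have "L_subset_le G (\<lambda>y. sup (\<eta> y) (L_conjugate G \<eta> t (inv x) y)) \<theta>"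
      unfolding L_subset_le_def
    proof (intro ballI sup_least)
      fix y assume y: "y \<in> carrier G"
      have "\<eta> y \<le> \<mu> y" using \<eta>\<mu> y by (simp add: L_subset_le_def)
      moreover have "\<eta> y \<le> s" if "y \<notin> K"
        using that SK y by (intro below) (auto simp: S L_level_def)
      ultimately show "\<eta> y \<le> \<theta> y" by (simp add: \<theta>_def)
      define h where "h = inv x \<otimes> y \<otimes> x"
      have h: "h \<in> carrier G" using x y by (simp add: h_def)
      have yh: "y = x \<otimes> h \<otimes> inv x"
        unfolding h_def by (rule conj_conj_inv[OF x y, symmetric])
      have eq: "L_conjugate G \<eta> t (inv x) y = inf t (\<eta> h)"
        using x by (simp add: L_conjugate_def h_def)
      have "\<eta> h \<le> \<mu> h" using \<eta>\<mu> h by (simp add: L_subset_le_def)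
      \<comment> \<open>The height \<open>t\<close> of the L-point is at most
        \<open>\<mu> x\<close>, so the conjugation bound for \<open>\<mu>\<close> becomes
        applicable.\<close>
      then have "inf t (\<eta> h) \<le> inf (\<mu> x) (\<mu> h)" using tx by (rule inf_mono[rotated])
      also have "\<dots> \<le> \<mu> y"
        using L_subgroup_conj[OF \<mu>, of "inv x" y] x y by (simp add: h_def L_subgroup_inv[OF \<mu>])
      finally have "inf t (\<eta> h) \<le> \<mu> y" .
      moreover have "inf t (\<eta> h) \<le> s" if "y \<notin> K"
      proof -
        \<comment> \<open>Otherwise \<open>y\<close>, the conjugate of \<open>h\<close> by
          \<open>x\<close>, would lie in \<open>S\<close> and so in \<open>K\<close>.\<close>
        have "h \<notin> ?H" using that SK yh by (auto simp: S)
        then show ?thesis using h by (intro below) (simp add: L_level_def)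
      qed
      ultimately show "L_conjugate G \<eta> t (inv x) y \<le> \<theta> y" by (simp add: eq \<theta>_def)
    qed
    ultimately have "L_generated G \<mu> \<eta> (L_conjugate G \<eta> t (inv x)) (inv x) \<le> \<theta> (inv x)"
      unfolding L_generated_def by (intro INF_lower) simp
    \<comment> \<open>Since \<open>\<mu>\<close> is invariant under inversion, the L-point of height
      \<open>t\<close> at \<open>inv x\<close> belongs to \<open>\<mu>\<close>, and abnormality
      applies to it.\<close>
    moreover have "t \<le> L_generated G \<mu> \<eta> (L_conjugate G \<eta> t (inv x)) (inv x)"
      using ab x tx \<mu> by (simp add: abnormal_L_subgroup_def L_point_in_def L_subgroup_inv)
    ultimately have "t \<le> \<theta> (inv x)" by (rule order_trans[rotated])
    moreover have "inv x \<notin> K" using subgroup.m_inv_closed[OF K, of "inv x"] xK x by auto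
    ultimately have "t \<le> s" by (simp add: \<theta>_def)
    with s show False by simp
  qed
  moreover have "subgroup ?H ?M"
    by (rule subgroup_incl[OF subH subM L_level_mono[OF \<eta>\<mu>]])
  ultimately show ?thesis using groupM by (simp add: abnormal_subgroup_def)
qed

theorem theorem3p4:
  fixes G :: "('g, 'b) monoid_scheme"
  assumes "group G"
  shows
    "(\<forall>(\<mu> :: 'g \<Rightarrow> 'l::complete_distrib_lattice) \<eta>.
        L_subgroup G \<mu> \<longrightarrow> L_subgroup_of G \<eta> \<mu> \<longrightarrow> L_tip G \<eta> = L_tip G \<mu> \<longrightarrow>
        (\<forall>t. t \<le> L_tip G \<eta> \<longrightarrow>
           abnormal_subgroup (L_level G \<eta> t) (G\<lparr>carrier := L_level G \<mu> t\<rparr>)) \<longrightarrow>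
        abnormal_L_subgroup G \<eta> \<mu>) \<and>
     (upper_well_ordered TYPE('l) \<longrightarrow>
       (\<forall>(\<mu> :: 'g \<Rightarrow> 'l) \<eta>.
          L_subgroup G \<mu> \<longrightarrow> L_subgroup_of G \<eta> \<mu> \<longrightarrow> abnormal_L_subgroup G \<eta> \<mu> \<longrightarrow>
          (\<forall>t. t \<le> L_tip G \<eta> \<longrightarrow>
             abnormal_subgroup (L_level G \<eta> t) (G\<lparr>carrier := L_level G \<mu> t\<rparr>))))"
proof -
  interpret group G by (rule assms)
  show ?thesis
  proof (intro conjI allI impI)
    fix \<mu> \<eta> :: "'g \<Rightarrow> 'l"
    assume "L_subgroup G \<mu>" "L_subgroup_of G \<eta> \<mu>" "L_tip G \<eta> = L_tip G \<mu>"
      and "\<forall>t. t \<le> L_tip G \<eta> \<longrightarrow>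
        abnormal_subgroup (L_level G \<eta> t) (G\<lparr>carrier := L_level G \<mu> t\<rparr>)"
    then show "abnormal_L_subgroup G \<eta> \<mu>" by (iprover intro: abnormal_L_subgroupI_levels)
  qed (rule abnormal_L_subgroup_level)
qed

end
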